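(* Fix a vehicle $k$ and let $L_1,L_2$ range over labels (of partial paths starting at the depot $\sigma$ and served by vehicle $k$). The following conditions form a valid dominance rule, i.e. $L_1$ dominates $L_2$ whenever $$i(L_1)=i(L_2),\quad t(L_1)\le t(L_2)-B,\quad \bar c(L_1)\le \bar c(L_2),\quad d(L_1)<d(L_2),\quad \mathcal S(L_1)\subseteq \mathcal S(L_2),$$ $$l_m^k(L_1)\le l_m^k(L_2)\ \text{ and }\ O_m^k(L_1)\subseteq O_m^k(L_2)\ \text{ for all } m\in\mathcal M_k$$ (with no condition on $g$ and $o$). That is, if $L_1$ and $L_2$ satisfy all these conditions, then for every feasible completion of $L_2$ to the destination $\delta$ there is a feasible completion of $L_1$ to $\delta$ whose final reduced cost is at most the final reduced cost of the completion of $L_2$ (so that discarding $L_2$ loses no optimal value of the pricing problem).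
   Context: **Instance.** Let $\mathcal G=(\mathcal V,\mathcal A)$ be a finite directed graph with $\mathcal V=\mathcal N\cup\{\sigma,\delta\}$, where $\mathcal N$ is the set of clients, and $\sigma$ and $\delta$ are the origin and destination copies of the depot. Each client $n\in\mathcal N$ has a demand $Q_n\ge 0$, a service duration $u_n\ge 0$, and a finite nonempty list of time windows $[s_n^1,e_n^1],\dots,[s_n^{\theta_n},e_n^{\theta_n}]$ for the start of service, which are pairwise disjoint, ordered chronologically, and nonnegative. Each arc $(i,j)\in\mathcal A$ has a travel cost $c_{ij}$, a travel duration $t_{ij}\ge 0$ and a travel distance $dist_{ij}\ge 0$; costs and durations satisfy the triangle inequality. The planning days are $\mathcal D$, a set of consecutive days numbered $0,1,\dots$. There is a maximum daily working time $T\ge 0$, a maximum daily driving distance $Dist\ge 0$ and a break length $B\ge 0$. Vehicle $k$ has capacity $L_k$ and a finite set of compartments $\mathcal M_k$, where $m\in\mathcal M_k$ has maximum capacity $\overline L_{mk}$ with $0\le\overline L_{mk}\le L_k$. The parameter $b_{nm}^k\in\{0,1\}$ equals $1$ iff client $n$ may be assigned to compartment $m$ of vehicle $k$; $f_{ij}\in\{0,1\}$ equals $1$ iff the items of clients $i$ and $j$ are compatible. Dual values $\pi_n\in\mathbb R$ ($n\in\mathcal N$) are given; put $\overline\pi_n=\pi_n$ for $n\in\mathcal N$, $\overline\pi_\sigma=\overline\pi_\delta=0$, and let $\overline c_{ij}=c_{ij}-\overline\pi_i$ be the reduced cost of arc $(i,j)$. Conventions for the depot: $u_\sigma=0$; $\delta$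 imposes no time-window restriction (window $[0,\infty)$), has zero demand and uses no compartment. **Labels.** A label is a tuple $L=(i,t,\bar c,d,\mathcal S,(l_m^k)_{m\in\mathcal M_k},(O_m^k)_{m\in\mathcal M_k},g,o)$, representing a partial path from $\sigma$ to $i$ served by vehicle $k$: $i(L)\in\mathcal V$ is the last visited node, $t(L)\ge0$ the accumulated time, $\bar c(L)\in\mathbb R$ the accumulated reduced cost, $d(L)\in\mathcal D$ the day, $\mathcal S(L)\subseteq\mathcal N$ the set of visited clients, $l_m^k(L)\ge0$ the load in compartment $m$, $O_m^k(L)\subseteq\mathcal N$ the clients loaded in compartment $m$, $g(L)\ge0$ the working time accumulated in the current day, and $o(L)\ge0$ the driving distance accumulated in the current day. The initial label is $(\sigma,0,0,0,\emptyset,(0)_m,(\emptyset)_m,0,0)$. Labels are those obtained from the initial label by successive feasible extensions. **Extensions.** An extension $h$ of $L$, with $i(L)=i$, along an arc $(i,j)\in\mathcal A$ is given by a compartment $m^h\in\mathcal M_k$ (if $j\in\mathcal N$) and a choice $d_{ij}\in\{0,1\}$, where $d_{ij}=1$ means that a break of length $B$ is taken immediately at $i$ before driving to $j$, so that deliveries start on the next day from $j$. It produces the label $L_h$ with - $i(L_h)=j$; - $t(L_h)=\max\{t(L)+t_{ij}+u_i+B\,d_{ij},\ s_j^{\bar p}\}$, where $\bar p$ is the smallest index $p$ with $t(L)+t_{ij}+u_i+B\,d_{ij}\le e_j^p$ (the earliest reachable window; if none exists, the extension is infeasible); - $\bar c(L_h)=\bar c(L)+\overline c_{ij}$; - $d(L_h)=d(L)+d_{ij}$;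 - $\mathcal S(L_h)=\mathcal S(L)\cup\{j\}$ if $j\in\mathcal N$ (unchanged if $j=\delta$); - $l_m^k(L_h)=l_m^k(L)+Q_j$ if $m=m^h$, and $l_m^k(L_h)=l_m^k(L)$ otherwise; - $O_m^k(L_h)=O_m^k(L)\cup\{j\}$ if $m=m^h$, and $O_m^k(L_h)=O_m^k(L)$ otherwise; - $g(L_h)=g(L)+t_{ij}+u_i$ if $d_{ij}=0$, and $g(L_h)=0$ if $d_{ij}=1$; - $o(L_h)=o(L)+dist_{ij}$ if $d_{ij}=0$, and $o(L_h)=0$ if $d_{ij}=1$. The extension is feasible iff $j\notin\mathcal S(L)$, $d(L_h)\in\mathcal D$, $t(L_h)\le e_j^{\bar p}$, $l_m^k(L_h)\le\overline L_{mk}$ for all $m\in\mathcal M_k$, $\sum_{m\in\mathcal M_k}l_m^k(L_h)\le L_k$, $g(L_h)\le T$, $o(L_h)\le Dist$, and, when $j\in\mathcal N$, $b_{j m^h}^k=1$ and $f_{nj}=1$ for all $n\in O_{m^h}^k(L)$. Feasibility is determined by exactly these conditions; in particular the day counter $d$ is not otherwise linked to the accumulated time or to the windows (days may be skipped). **Completion and validity.** A feasible completion of $L$ is a finite (possibly empty) sequence of successive feasible extensions starting from $L$ and ending in a label at $\delta$; its final reduced cost is the $\bar c$-value of that last label. Labels at $\delta$ are not extended further. A dominance rule (a set of conditions on pairs $(L_1,L_2)$) is valid if, whenever $(L_1,L_2)$ satisfies it, each feasible completion of $L_2$ is matched by a feasible completion of $L_1$ with final reduced cost no larger. *)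

theory Defs
  imports Complex_Main "HOL-Library.Extended_Real"
begin

text \<open>
  Pricing problem of a multi-day, multi-compartment, multiple-time-window routing problem.
  Nodes have type \<open>'v\<close>, vehicles type \<open>'k\<close>, compartments type \<open>'m\<close>.
\<close>

record ('v, 'k, 'm) vrp =
  clients :: "'v set"
  origin :: 'v
  destination :: 'v
  arcs :: "('v \<times> 'v) set"
  demand :: "'v \<Rightarrow> real"
  service :: "'v \<Rightarrow> real"
  windows :: "'v \<Rightarrow> (real \<times> real) list"
  cost :: "'v \<Rightarrow> 'v \<Rightarrow> real"
  duration :: "'v \<Rightarrow> 'v \<Rightarrow> real"
  distance :: "'v \<Rightarrow> 'v \<Rightarrow> real"
  days :: "nat set"
  max_work :: real
  max_distance :: real
  break_length :: real
  vehicles :: "'k set"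
  capacity :: "'k \<Rightarrow> real"
  compartments :: "'k \<Rightarrow> 'm set"
  compartment_capacity :: "'k \<Rightarrow> 'm \<Rightarrow> real"
  allowed :: "'k \<Rightarrow> 'v \<Rightarrow> 'm \<Rightarrow> bool"
  compatible :: "'v \<Rightarrow> 'v \<Rightarrow> bool"
  dual :: "'v \<Rightarrow> real"

definition nodes :: "('v, 'k, 'm) vrp \<Rightarrow> 'v set" where
  "nodes I = clients I \<union> {origin I, destination I}"

definition wf_windows :: "(real \<times> real) list \<Rightarrow> bool" where
  "wf_windows ws \<longleftrightarrow>
     ws \<noteq> [] \<and>
     (\<forall>(s, e) \<in> set ws. 0 \<le> s \<and> s \<le> e) \<and>
     sorted_wrt (\<lambda>(s, e) (s', e'). e < s') ws"

definition triangle_inequality :: "('v \<times> 'v) set \<Rightarrow> ('v \<Rightarrow> 'v \<Rightarrow> real) \<Rightarrow> bool" where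
  "triangle_inequality A w \<longleftrightarrow>
     (\<forall>i j l. (i, j) \<in> A \<and> (j, l) \<in> A \<and> (i, l) \<in> A \<longrightarrow> w i l \<le> w i j + w j l)"

text \<open>
  Client data is only constrained on \<^term>\<open>clients I\<close>, arc data only on \<^term>\<open>arcs I\<close>.
  The days are any nonempty initial segment of the naturals; the initial label is on day 0.
\<close>

definition wf_vrp :: "('v, 'k, 'm) vrp \<Rightarrow> bool" where
  "wf_vrp I \<longleftrightarrow>
     finite (clients I) \<and>
     origin I \<notin> clients I \<and> destination I \<notin> clients I \<and> origin I \<noteq> destination I \<and>
     arcs I \<subseteq> nodes I \<times> nodes I \<and>
     (\<forall>n \<in> clients I. 0 \<le> demand I n \<and> 0 \<le> service I n \<and> wf_windows (windows I n)) \<and>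
     (\<forall>(i, j) \<in> arcs I. 0 \<le> duration I i j \<and> 0 \<le> distance I i j) \<and>
     triangle_inequality (arcs I) (cost I) \<and>
     triangle_inequality (arcs I) (duration I) \<and>
     0 \<in> days I \<and> (\<forall>d \<in> days I. \<forall>d' \<le> d. d' \<in> days I) \<and>
     0 \<le> max_work I \<and> 0 \<le> max_distance I \<and> 0 \<le> break_length I \<and>
     (\<forall>k \<in> vehicles I. finite (compartments I k) \<and>
        (\<forall>m \<in> compartments I k.
           0 \<le> compartment_capacity I k m \<and> compartment_capacity I k m \<le> capacity I k))"

text \<open>Depot conventions: no service time, no dual value, and the destination is always open.\<close>

definition service_time :: "('v, 'k, 'm) vrp \<Rightarrow> 'v \<Rightarrow> real" where
  "service_time I i = (if i \<in> clients I then service I i else 0)"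

definition node_dual :: "('v, 'k, 'm) vrp \<Rightarrow> 'v \<Rightarrow> real" where
  "node_dual I i = (if i \<in> clients I then dual I i else 0)"

definition reduced_cost :: "('v, 'k, 'm) vrp \<Rightarrow> 'v \<Rightarrow> 'v \<Rightarrow> real" where
  "reduced_cost I i j = cost I i j - node_dual I i"

definition node_windows :: "('v, 'k, 'm) vrp \<Rightarrow> 'v \<Rightarrow> (real \<times> ereal) list" where
  "node_windows I j =
     (if j = destination I then [(0, \<infinity>)] else map (\<lambda>(s, e). (s, ereal e)) (windows I j))"

definition reachable_window :: "('v, 'k, 'm) vrp \<Rightarrow> 'v \<Rightarrow> real \<Rightarrow> nat \<Rightarrow> bool" where
  "reachable_window I j a p \<longleftrightarrow>
     p < length (node_windows I j) \<and> ereal a \<le> snd (node_windows I j ! p)"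

text \<open>Meaningful only if some window of \<open>j\<close> is reachable at arrival time \<open>a\<close>.\<close>

definition earliest_window :: "('v, 'k, 'm) vrp \<Rightarrow> 'v \<Rightarrow> real \<Rightarrow> real \<times> ereal" where
  "earliest_window I j a = node_windows I j ! (LEAST p. reachable_window I j a p)"

text \<open>
  The fields \<open>load\<close> and \<open>loaded\<close> matter only on the compartments of the vehicle under
  consideration; elsewhere they keep their initial values.
\<close>

record ('v, 'm) label =
  node :: 'v
  time :: real
  rcost :: real
  day :: nat
  visited :: "'v set"
  load :: "'m \<Rightarrow> real"
  loaded :: "'m \<Rightarrow> 'v set"
  work :: real
  driven :: real

definition initial_label :: "('v, 'k, 'm) vrp \<Rightarrow> ('v, 'm) label" where
  "initial_label I =
     \<lparr>node = origin I, time = 0, rcost = 0, day = 0, visited = {},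
      load = (\<lambda>_. 0), loaded = (\<lambda>_. {}), work = 0, driven = 0\<rparr>"

text \<open>
  An extension is given by the head of the arc, the compartment used (\<^const>\<open>None\<close> exactly when
  the head is the destination), and whether a break is taken before driving.
\<close>

record ('v, 'm) extension =
  target :: 'v
  compartment :: "'m option"
  brk :: bool

definition is_extension ::
  "('v, 'k, 'm) vrp \<Rightarrow> 'k \<Rightarrow> ('v, 'm) label \<Rightarrow> ('v, 'm) extension \<Rightarrow> bool" where
  "is_extension I k L h \<longleftrightarrow>
     node L \<noteq> destination I \<and>
     (node L, target h) \<in> arcs I \<and>
     (target h \<in> clients I \<and> (\<exists>m \<in> compartments I k. compartment h = Some m) \<or>
      target h = destination I \<and> compartment h = None)"

definition arrival ::
  "('v, 'k, 'm) vrp \<Rightarrow> ('v, 'm) label \<Rightarrow> ('v, 'm) extension \<Rightarrow> real" where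
  "arrival I L h =
     time L + duration I (node L) (target h) + service_time I (node L)
       + break_length I * of_bool (brk h)"

definition extend ::
  "('v, 'k, 'm) vrp \<Rightarrow> ('v, 'm) label \<Rightarrow> ('v, 'm) extension \<Rightarrow> ('v, 'm) label" where
  "extend I L h =
     (let i = node L; j = target h in
      \<lparr>node = j,
       time = max (arrival I L h) (fst (earliest_window I j (arrival I L h))),
       rcost = rcost L + reduced_cost I i j,
       day = day L + of_bool (brk h),
       visited = (if j \<in> clients I then visited L \<union> {j} else visited L),
       load = (\<lambda>m. if compartment h = Some m then load L m + demand I j else load L m),
       loaded = (\<lambda>m. if compartment h = Some m then loaded L m \<union> {j} else loaded L m),
       work = (if brk h then 0 else work L + duration I i j + service_time I i),
       driven = (if brk h then 0 else driven L + distance I i j)\<rparr>)"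

definition feasible_extension ::
  "('v, 'k, 'm) vrp \<Rightarrow> 'k \<Rightarrow> ('v, 'm) label \<Rightarrow> ('v, 'm) extension \<Rightarrow> bool" where
  "feasible_extension I k L h \<longleftrightarrow>
     (let j = target h; a = arrival I L h; L' = extend I L h in
      is_extension I k L h \<and>
      j \<notin> visited L \<and>
      day L' \<in> days I \<and>
      (\<exists>p. reachable_window I j a p) \<and>
      ereal (time L') \<le> snd (earliest_window I j a) \<and>
      (\<forall>m \<in> compartments I k. load L' m \<le> compartment_capacity I k m) \<and>
      (\<Sum>m \<in> compartments I k. load L' m) \<le> capacity I k \<and>
      work L' \<le> max_work I \<and>
      driven L' \<le> max_distance I \<and>
      (j \<in> clients I \<longrightarrow>
        allowed I k j (the (compartment h)) \<and>
        (\<forall>n \<in> loaded L (the (compartment h)). compatible I n j)))"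

inductive_set labels :: "('v, 'k, 'm) vrp \<Rightarrow> 'k \<Rightarrow> ('v, 'm) label set"
  for I :: "('v, 'k, 'm) vrp" and k :: 'k where
  initial: "initial_label I \<in> labels I k"
| extension: "L \<in> labels I k \<Longrightarrow> feasible_extension I k L h \<Longrightarrow> extend I L h \<in> labels I k"

fun feasible_extensions ::
  "('v, 'k, 'm) vrp \<Rightarrow> 'k \<Rightarrow> ('v, 'm) label \<Rightarrow> ('v, 'm) extension list \<Rightarrow> bool" where
  "feasible_extensions I k L [] \<longleftrightarrow> True"
| "feasible_extensions I k L (h # hs) \<longleftrightarrow>
     feasible_extension I k L h \<and> feasible_extensions I k (extend I L h) hs"

definition final_label ::
  "('v, 'k, 'm) vrp \<Rightarrow> ('v, 'm) label \<Rightarrow> ('v, 'm) extension list \<Rightarrow> ('v, 'm) label" where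
  "final_label I L hs = foldl (extend I) L hs"

definition feasible_completion ::
  "('v, 'k, 'm) vrp \<Rightarrow> 'k \<Rightarrow> ('v, 'm) label \<Rightarrow> ('v, 'm) extension list \<Rightarrow> bool" where
  "feasible_completion I k L hs \<longleftrightarrow>
     feasible_extensions I k L hs \<and> node (final_label I L hs) = destination I"

definition valid_dominance_rule ::
  "('v, 'k, 'm) vrp \<Rightarrow> 'k \<Rightarrow> (('v, 'm) label \<Rightarrow> ('v, 'm) label \<Rightarrow> bool) \<Rightarrow> bool" where
  "valid_dominance_rule I k R \<longleftrightarrow>
     (\<forall>L1 \<in> labels I k. \<forall>L2 \<in> labels I k. R L1 L2 \<longrightarrow>
       (\<forall>hs2. feasible_completion I k L2 hs2 \<longrightarrow>
         (\<exists>hs1. feasible_completion I k L1 hs1 \<and>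
            rcost (final_label I L1 hs1) \<le> rcost (final_label I L2 hs2))))"

end

theory Submission
  imports Defs
begin

text \<open>
  The rule puts no condition on working time and driving distance because a single break repairs
  both. Let \<open>L1\<close> and \<open>L2\<close> satisfy it and take a completion of \<open>L2\<close>. If it is empty, then \<open>L1\<close> is
  at the destination as well. Otherwise \<open>L1\<close> follows the same nodes and compartments, but always
  takes a break before its first arc. The head start of \<open>break_length I\<close> pays for this break, so
  \<open>L1\<close> arrives no later than \<open>L2\<close>; the strictly smaller day counter pays for the additional day;
  and the daily counters of \<open>L1\<close> are now \<open>0\<close>, the least value a counter of a label can have
  (\<open>counters_nonneg\<close>).

  After this step \<open>L1\<close> is no worse than \<open>L2\<close> in every resource (\<open>no_worse\<close>), and from there \<open>L1\<close> can
  copy the completion of \<open>L2\<close> literally (\<open>no_worse_completion\<close>). The one-step argument behind both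
  the first arc and the later ones is \<open>extend_no_worse\<close>: beyond the current node, the constraints
  depend on a label only through resources that are bounded from above and sets whose elements
  exclude clients, so that having less never hurts. The least obvious resource is time, where an
  earlier arrival may use an earlier window; since windows are ordered, that window also opens
  earlier (\<open>earliest_window_mono\<close>).
\<close>

definition no_worse ::
  "('v, 'k, 'm) vrp \<Rightarrow> 'k \<Rightarrow> ('v, 'm) label \<Rightarrow> ('v, 'm) label \<Rightarrow> bool" where
  "no_worse I k L1 L2 \<longleftrightarrow>
     node L1 = node L2 \<and> time L1 \<le> time L2 \<and> rcost L1 \<le> rcost L2 \<and> day L1 \<le> day L2 \<and>
     visited L1 \<subseteq> visited L2 \<and>
     (\<forall>m \<in> compartments I k. load L1 m \<le> load L2 m \<and> loaded L1 m \<subseteq> loaded L2 m) \<and>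
     work L1 \<le> work L2 \<and> driven L1 \<le> driven L2"

lemma node_windows_ordered:
  assumes "wf_vrp I" and "j \<in> clients I \<or> j = destination I"
  shows "\<forall>(s, e) \<in> set (node_windows I j). ereal s \<le> e"
    and "sorted_wrt (\<lambda>(s, e) (s', e'). s \<le> s') (node_windows I j)"
proof -
  have *: "wf_windows (windows I j)" if "j \<noteq> destination I"
    using assms that unfolding wf_vrp_def by blast
  show "\<forall>(s, e) \<in> set (node_windows I j). ereal s \<le> e"
    using * by (auto simp: node_windows_def wf_windows_def)
  show "sorted_wrt (\<lambda>(s, e) (s', e'). s \<le> s') (node_windows I j)"
  proof (cases "j = destination I")
    case False
    \<comment> \<open>Opening times increase because each window closes before the next one opens.\<close>
    have "sorted_wrt (\<lambda>(s, e) (s', e'). s \<le> s') (windows I j)"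
      by (rule sorted_wrt_mono_rel[where P = "\<lambda>(s, e) (s', e'). e < s'"])
        (use *[OF False] in \<open>force simp: wf_windows_def\<close>)+
    then show ?thesis
      using False by (simp add: node_windows_def sorted_wrt_map case_prod_unfold)
  qed (simp add: node_windows_def)
qed

lemma reachable_window_earlier:
  assumes "a \<le> b" and "reachable_window I j b p"
  shows "reachable_window I j a p"
  using assms by (auto simp: reachable_window_def intro: order_trans[of "ereal a" "ereal b"])

lemma reachable_earliest_window:
  assumes "reachable_window I j a p"
  shows "reachable_window I j a (LEAST p. reachable_window I j a p)"
  using assms by (rule LeastI)

text \<open>
  Every window still reachable at the later arrival \<open>b\<close> is reachable at \<open>a\<close>, so the least reachable
  index can only decrease, and opening times increase with the index.
\<close>

lemma earliest_window_mono:
  assumes "wf_vrp I" and "j \<in> clients I \<or> j = destination I"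
    and "a \<le> b" and "reachable_window I j b p"
  shows "fst (earliest_window I j a) \<le> fst (earliest_window I j b)"
proof -
  let ?p = "\<lambda>a. LEAST p. reachable_window I j a p"
  have b: "reachable_window I j b (?p b)"
    using assms(4) by (rule reachable_earliest_window)
  then have "reachable_window I j a (?p b)"
    by (rule reachable_window_earlier[OF assms(3)])
  then have "?p a \<le> ?p b"
    by (rule Least_le)
  moreover have "?p b < length (node_windows I j)"
    using b by (simp add: reachable_window_def)
  ultimately show ?thesis
    using sorted_wrt_nth_less[OF node_windows_ordered(2)[OF assms(1,2)], of "?p a" "?p b"]
    by (cases "?p a = ?p b") (auto simp: earliest_window_def case_prod_unfold)
qed

lemma earliest_window_not_missed:
  assumes "wf_vrp I" and "j \<in> clients I \<or> j = destination I" and "reachable_window I j a p"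
  shows "ereal (max a (fst (earliest_window I j a))) \<le> snd (earliest_window I j a)"
proof -
  have r: "reachable_window I j a (LEAST p. reachable_window I j a p)"
    using assms(3) by (rule reachable_earliest_window)
  then have "earliest_window I j a \<in> set (node_windows I j)"
    by (simp add: earliest_window_def reachable_window_def)
  then have "ereal (fst (earliest_window I j a)) \<le> snd (earliest_window I j a)"
    using node_windows_ordered(1)[OF assms(1,2)] by (auto simp: case_prod_unfold)
  moreover have "ereal a \<le> snd (earliest_window I j a)"
    using r by (simp add: earliest_window_def reachable_window_def)
  ultimately show ?thesis
    by (simp add: max_def)
qed

text \<open>
  The two extensions may differ in the break decision. A break trades time and a day for fresh
  daily counters, so the four resources it affects are compared after the extension (arrival
  standing for time), and the remaining ones before it.
\<close>

lemma extend_no_worse: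
  assumes wf: "wf_vrp I"
    and feas: "feasible_extension I k L2 h2"
    and h: "target h1 = target h2" "compartment h1 = compartment h2"
    and before: "node L1 = node L2" "rcost L1 \<le> rcost L2" "visited L1 \<subseteq> visited L2"
      "\<forall>m \<in> compartments I k. load L1 m \<le> load L2 m \<and> loaded L1 m \<subseteq> loaded L2 m"
    and arrive: "arrival I L1 h1 \<le> arrival I L2 h2"
    and after: "day (extend I L1 h1) \<le> day (extend I L2 h2)"
      "work (extend I L1 h1) \<le> work (extend I L2 h2)"
      "driven (extend I L1 h1) \<le> driven (extend I L2 h2)"
  shows "feasible_extension I k L1 h1 \<and> no_worse I k (extend I L1 h1) (extend I L2 h2)"
proof -
  let ?j = "target h2" and ?L1 = "extend I L1 h1" and ?L2 = "extend I L2 h2"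
  have ext: "is_extension I k L2 h2"
    using feas by (simp add: feasible_extension_def Let_def)
  then have j: "?j \<in> clients I \<or> ?j = destination I"
    by (auto simp: is_extension_def)
  obtain p where p: "reachable_window I ?j (arrival I L2 h2) p"
    using feas by (auto simp: feasible_extension_def Let_def)
  then have p': "reachable_window I ?j (arrival I L1 h1) p"
    by (rule reachable_window_earlier[OF arrive])
  have better: "no_worse I k ?L1 ?L2"
    unfolding no_worse_def
  proof (intro conjI)
    show "time ?L1 \<le> time ?L2"
      using earliest_window_mono[OF wf j arrive p] arrive h
      by (auto simp: extend_def Let_def max_def)
  qed (use before after h in \<open>auto simp: extend_def Let_def\<close>)
  have loads: "load ?L1 m \<le> load ?L2 m" if "m \<in> compartments I k" for m
    using better that by (simp add: no_worse_def)
  have "feasible_extension I k L1 h1"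
    unfolding feasible_extension_def Let_def
  proof (intro conjI)
    show "is_extension I k L1 h1"
      using ext h before(1) by (simp add: is_extension_def)
    show "target h1 \<notin> visited L1"
      using feas h before(3) by (auto simp: feasible_extension_def Let_def)
    show "day ?L1 \<in> days I"
      using feas after(1) wf unfolding feasible_extension_def Let_def wf_vrp_def by blast
    show "\<exists>p. reachable_window I (target h1) (arrival I L1 h1) p"
      using p' h by auto
    show "ereal (time ?L1) \<le> snd (earliest_window I (target h1) (arrival I L1 h1))"
      using earliest_window_not_missed[OF wf j p'] h by (simp add: extend_def Let_def)
    show "\<forall>m \<in> compartments I k. load ?L1 m \<le> compartment_capacity I k m"
      using feas loads by (auto simp: feasible_extension_def Let_def intro: order_trans)
    show "(\<Sum>m \<in> compartments I k. load ?L1 m) \<le> capacity I k"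
      using feas sum_mono[of "compartments I k" "load ?L1" "load ?L2", OF loads]
      by (auto simp: feasible_extension_def Let_def)
    show "work ?L1 \<le> max_work I" "driven ?L1 \<le> max_distance I"
      using feas after(2,3) by (auto simp: feasible_extension_def Let_def)
    show "target h1 \<in> clients I \<longrightarrow> allowed I k (target h1) (the (compartment h1)) \<and>
        (\<forall>n \<in> loaded L1 (the (compartment h1)). compatible I n (target h1))"
    proof
      assume "target h1 \<in> clients I"
      then obtain m where m: "m \<in> compartments I k" "compartment h2 = Some m"
        using ext h wf by (auto simp: is_extension_def wf_vrp_def)
      then show "allowed I k (target h1) (the (compartment h1)) \<and>
          (\<forall>n \<in> loaded L1 (the (compartment h1)). compatible I n (target h1))"
        using \<open>target h1 \<in> clients I\<close> feas before(4) h
        by (auto simp: feasible_extension_def Let_def)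
    qed
  qed
  with better show ?thesis by blast
qed

lemma no_worse_completion:
  assumes "wf_vrp I" and "no_worse I k L1 L2" and "feasible_completion I k L2 hs"
  shows "feasible_completion I k L1 hs \<and>
    rcost (final_label I L1 hs) \<le> rcost (final_label I L2 hs)"
  using assms(2,3)
proof (induction hs arbitrary: L1 L2)
  case Nil
  then show ?case
    by (simp add: feasible_completion_def final_label_def no_worse_def)
next
  case (Cons h hs)
  have "feasible_extension I k L2 h"
    using Cons.prems(2) by (simp add: feasible_completion_def)
  from extend_no_worse[OF assms(1) this, of h L1]
  have "feasible_extension I k L1 h \<and> no_worse I k (extend I L1 h) (extend I L2 h)"
    using Cons.prems(1) by (auto simp: no_worse_def arrival_def extend_def Let_def)
  then show ?case
    using Cons.IH[of "extend I L1 h" "extend I L2 h"] Cons.prems(2)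
    by (simp add: feasible_completion_def final_label_def)
qed

lemma counters_nonneg:
  assumes "wf_vrp I" and "L \<in> labels I k"
  shows "0 \<le> work L \<and> 0 \<le> driven L"
  using assms(2)
proof induction
  case initial
  then show ?case
    by (simp add: initial_label_def)
next
  case (extension L h)
  have "(node L, target h) \<in> arcs I"
    using extension.hyps(2) by (simp add: feasible_extension_def is_extension_def Let_def)
  then have "0 \<le> duration I (node L) (target h)" "0 \<le> distance I (node L) (target h)"
    using assms(1) unfolding wf_vrp_def by blast+
  moreover have "0 \<le> service_time I (node L)"
    using assms(1) by (simp add: wf_vrp_def service_time_def)
  ultimately show ?case
    using extension.IH by (simp add: extend_def Let_def)
qed

theorem proposition2:
  fixes I :: "('v, 'k, 'm) vrp" and k :: 'k
  assumes "wf_vrp I" and "k \<in> vehicles I"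
  shows "valid_dominance_rule I k (\<lambda>L1 L2.
    node L1 = node L2 \<and>
    time L1 \<le> time L2 - break_length I \<and>
    rcost L1 \<le> rcost L2 \<and>
    day L1 < day L2 \<and>
    visited L1 \<subseteq> visited L2 \<and>
    (\<forall>m \<in> compartments I k. load L1 m \<le> load L2 m \<and> loaded L1 m \<subseteq> loaded L2 m))"
  unfolding valid_dominance_rule_def
proof (intro ballI allI impI, elim conjE)
  fix L1 L2 :: "('v, 'm) label" and hs2
  assume L2: "L2 \<in> labels I k"
    and le: "node L1 = node L2" "rcost L1 \<le> rcost L2" "visited L1 \<subseteq> visited L2"
      "\<forall>m \<in> compartments I k. load L1 m \<le> load L2 m \<and> loaded L1 m \<subseteq> loaded L2 m"
    and slack: "time L1 \<le> time L2 - break_length I" "day L1 < day L2"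
    and compl: "feasible_completion I k L2 hs2"
  show "\<exists>hs1. feasible_completion I k L1 hs1 \<and>
    rcost (final_label I L1 hs1) \<le> rcost (final_label I L2 hs2)"
  proof (cases hs2)
    case Nil
    then show ?thesis
      using le compl
      by (intro exI[of _ "[]"]) (simp add: feasible_completion_def final_label_def)
  next
    case (Cons h hs)
    let ?h = "h\<lparr>brk := True\<rparr>"
    have feas: "feasible_extension I k L2 h"
      using compl Cons by (simp add: feasible_completion_def)
    have B: "0 \<le> break_length I"
      using assms(1) by (simp add: wf_vrp_def)
    have arrive: "arrival I L1 ?h \<le> arrival I L2 h"
      using slack(1) le(1) B by (auto simp: arrival_def)
    have day: "day (extend I L1 ?h) \<le> day (extend I L2 h)"
      using slack(2) by (simp add: extend_def Let_def)
    have "0 \<le> work (extend I L2 h) \<and> 0 \<le> driven (extend I L2 h)"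
      by (rule counters_nonneg[OF assms(1) labels.extension[OF L2 feas]])
    then have counters: "work (extend I L1 ?h) \<le> work (extend I L2 h)"
      "driven (extend I L1 ?h) \<le> driven (extend I L2 h)"
      by (simp_all add: extend_def Let_def)
    have step: "feasible_extension I k L1 ?h" "no_worse I k (extend I L1 ?h) (extend I L2 h)"
      using extend_no_worse[OF assms(1) feas _ _ le arrive day counters] by simp_all
    have "feasible_completion I k (extend I L2 h) hs"
      using compl Cons by (simp add: feasible_completion_def final_label_def)
    from no_worse_completion[OF assms(1) step(2) this] step(1) Cons show ?thesis
      by (intro exI[of _ "?h # hs"]) (simp add: feasible_completion_def final_label_def)
  qed
qed

end
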